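(* Let $\Bbbk$ be an algebraically closed field of characteristic zero. Let $r,s,a,b$ be positive integers with $a\le b$, $r\ge s$, $d=\gcd(r,s)$, and let $\lambda=p/q>0$ in lowest terms, such that \[ B=\begin{bmatrix} r & s\\ -\lambda r & -\lambda s\\ a & b\end{bmatrix} \] is an integer matrix of rank $2$. Let $I(B)=\langle x^rz^a-y^{\lambda r},\ x^sz^b-y^{\lambda s}\rangle\subseteq \Bbbk[x,y,z]$. Then the primary component of $I(B)$ corresponding to the associated prime $\langle x,y\rangle$ is \[ (I(B):z^\infty)+\big\langle y^{\lambda(r+s-d)},\ x^dy^{\lambda(r+s-2d)},\ x^{2d}y^{\lambda(r+s-3d)},\ \dots,\ x^{r+s-d}\big\rangle . \]
   Context: $(I:z^\infty)$ denotes the saturation $\{g\in\Bbbk[x,y,z]\mid z^m g\in I \text{ for some } m\ge 0\}$. *)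

theory Defs
  imports "HOL-Library.Poly_Mapping" "HOL-Library.Product_Plus"
    "HOL-Computational_Algebra.Polynomial"
begin

text \<open>The polynomial ring k[x,y,z]: finitely supported functions from exponent
  vectors (i,j,l) (monomial x^i y^j z^l) to coefficients.\<close>
type_synonym 'k mpoly3 = "(nat \<times> nat \<times> nat) \<Rightarrow>\<^sub>0 'k"

definition varX :: "'k::comm_ring_1 mpoly3" where
  "varX = Poly_Mapping.single (1, 0, 0) 1"
definition varY :: "'k::comm_ring_1 mpoly3" where
  "varY = Poly_Mapping.single (0, 1, 0) 1"
definition varZ :: "'k::comm_ring_1 mpoly3" where
  "varZ = Poly_Mapping.single (0, 0, 1) 1"

definition gen_ideal :: "'a::comm_ring_1 set \<Rightarrow> 'a set" where
  "gen_ideal S = {(\<Sum>g\<in>F. c g * g) | F c. finite F \<and> F \<subseteq> S}"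

definition is_ideal :: "'a::comm_ring_1 set \<Rightarrow> bool" where
  "is_ideal I \<longleftrightarrow> 0 \<in> I \<and> (\<forall>f\<in>I. \<forall>g\<in>I. f + g \<in> I) \<and> (\<forall>f\<in>I. \<forall>h. h * f \<in> I)"

definition radical :: "'a::comm_ring_1 set \<Rightarrow> 'a set" where
  "radical I = {f. \<exists>n. f ^ n \<in> I}"

definition primary_ideal :: "'a::comm_ring_1 set \<Rightarrow> bool" where
  "primary_ideal Q \<longleftrightarrow> is_ideal Q \<and> Q \<noteq> UNIV \<and>
     (\<forall>f g. f * g \<in> Q \<longrightarrow> f \<in> Q \<or> g \<in> radical Q)"

definition saturation :: "'a::comm_ring_1 set \<Rightarrow> 'a \<Rightarrow> 'a set" where
  "saturation I z = {g. \<exists>m. z ^ m * g \<in> I}"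

definition is_primary_component :: "'a::comm_ring_1 set \<Rightarrow> 'a set \<Rightarrow> 'a set \<Rightarrow> bool" where
  "is_primary_component I P Q \<longleftrightarrow> primary_ideal Q \<and> radical Q = P \<and>
     (\<exists>Qs. (\<forall>Q'\<in>set Qs. primary_ideal Q' \<and> radical Q' \<noteq> P) \<and> I = Q \<inter> \<Inter>(set Qs))"

text \<open>For a rational lam with lam*n integral, the integer lam*n as a nat.\<close>
definition lexp :: "rat \<Rightarrow> nat \<Rightarrow> nat" where
  "lexp lam n = nat \<lfloor>lam * of_nat n\<rfloor>"

end

theory Submission
  imports Defs "HOL-Number_Theory.Cong"
begin

text \<open>Put \<open>u = x^d\<close>, \<open>v = y^(\<lambda> d)\<close>, \<open>r = d r'\<close>, \<open>s = d s'\<close> and \<open>n = r' + s'\<close>.  The component at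
  \<open>\<langle>x, y\<rangle>\<close> is the set of all \<open>f\<close> with \<open>h f \<in> I\<close> for some \<open>h \<notin> \<langle>x, y\<rangle>\<close>.  Modulo \<open>I\<close>, the monomials
  \<open>u^i v^(k-i)\<close> are linked by \<open>u^i v^(k-i) = z^a u^(i+r') v^(k-i-r')\<close> and the analogous relation
  with \<open>s'\<close> and \<open>b\<close>.  For \<open>k = n - 1\<close> these links form a cycle whose monodromy
  \<open>z^(b r') - z^(a s')\<close> is nonzero by the rank condition and annihilates the monomials, so they
  lie in the component.  For \<open>k < n - 1\<close> the links form a forest, hence up to \<open>z\<close>-torsion the quotient
  is a torsion-free \<open>k[z]\<close>-module and nothing beyond the saturation is added.  The remaining
  primary ideals come from a primary decomposition of \<open>I\<close>, which exists because \<open>k[x,y,z]\<close> is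
  Noetherian.\<close>

subsection \<open>Ideals\<close>

lemma is_idealD:
  assumes "is_ideal J"
  shows "0 \<in> J" "f \<in> J \<Longrightarrow> g \<in> J \<Longrightarrow> f + g \<in> J" "f \<in> J \<Longrightarrow> h * f \<in> J"
  using assms by (auto simp: is_ideal_def)

lemma is_ideal_diff: "is_ideal J \<Longrightarrow> f \<in> J \<Longrightarrow> g \<in> J \<Longrightarrow> f - g \<in> J"
  using is_idealD(2)[of J f "-1 * g"] is_idealD(3)[of J g "-1"] by simp

lemma is_ideal_sum: "is_ideal J \<Longrightarrow> (\<And>i. i \<in> A \<Longrightarrow> f i \<in> J) \<Longrightarrow> sum f A \<in> J"
  by (induction A rule: infinite_finite_induct) (auto simp: is_idealD)

lemma gen_ideal_is_ideal: "is_ideal (gen_ideal S)"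
proof -
  have "f + g \<in> gen_ideal S" if fg: "f \<in> gen_ideal S" "g \<in> gen_ideal S" for f g
  proof -
    obtain F c where F: "f = (\<Sum>x\<in>F. c x * x)" "finite F" "F \<subseteq> S"
      using fg(1) by (auto simp: gen_ideal_def)
    obtain G e where G: "g = (\<Sum>x\<in>G. e x * x)" "finite G" "G \<subseteq> S"
      using fg(2) by (auto simp: gen_ideal_def)
    \<comment> \<open>The supports \<open>F\<close> and \<open>G\<close> may overlap, so each
      coefficient function is padded by \<open>0\<close> outside its own support before the two are
      added.\<close>
    define k where "k x = (if x \<in> F then c x else 0) + (if x \<in> G then e x else 0)" for x
    have "(\<Sum>x\<in>F \<union> G. k x * x) = (\<Sum>x\<in>F \<union> G. if x \<in> F then c x * x else 0) +
        (\<Sum>x\<in>F \<union> G. if x \<in> G then e x * x else 0)"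
      unfolding sum.distrib[symmetric] k_def by (intro sum.cong) (auto simp: distrib_right)
    also have "(\<Sum>x\<in>F \<union> G. if x \<in> F then c x * x else 0) = f"
      unfolding F(1) using F(2) G(2) by (intro sum.mono_neutral_cong_right) auto
    also have "(\<Sum>x\<in>F \<union> G. if x \<in> G then e x * x else 0) = g"
      unfolding G(1) using F(2) G(2) by (intro sum.mono_neutral_cong_right) auto
    finally show ?thesis
      using F G unfolding gen_ideal_def by (auto intro!: exI[of _ "F \<union> G"] exI[of _ k])
  qed
  moreover have "h * f \<in> gen_ideal S" if f: "f \<in> gen_ideal S" for f h
  proof -
    obtain F c where F: "f = (\<Sum>x\<in>F. c x * x)" "finite F" "F \<subseteq> S"
      using f by (auto simp: gen_ideal_def)
    have "h * f = (\<Sum>x\<in>F. (h * c x) * x)"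
      by (simp add: F(1) sum_distrib_left mult.assoc)
    then show ?thesis
      using F(2,3) unfolding gen_ideal_def by (auto intro!: exI[of _ F] exI[of _ "\<lambda>x. h * c x"])
  qed
  moreover have "0 \<in> gen_ideal S"
    unfolding gen_ideal_def by (auto intro!: exI[of _ "{}"])
  ultimately show ?thesis by (auto simp: is_ideal_def)
qed

lemma gen_ideal_superset: "g \<in> S \<Longrightarrow> g \<in> gen_ideal S"
  unfolding gen_ideal_def by (auto intro!: exI[of _ "{g}"] exI[of _ "\<lambda>_. 1"])

lemma gen_ideal_least: "is_ideal J \<Longrightarrow> S \<subseteq> J \<Longrightarrow> gen_ideal S \<subseteq> J"
  by (auto simp: gen_ideal_def subset_iff intro!: is_ideal_sum is_idealD(3))

lemma gen_ideal_mono: "S \<subseteq> T \<Longrightarrow> gen_ideal S \<subseteq> gen_ideal T"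
  by (meson gen_ideal_is_ideal gen_ideal_least gen_ideal_superset subset_iff)

lemma gen_ideal_insertE:
  assumes "f \<in> gen_ideal (insert g J)" "is_ideal J"
  obtains c j where "j \<in> J" "f = j + c * g"
proof -
  let ?J = "{j + c * g |j c. j \<in> J}"
  have "is_ideal ?J"
    unfolding is_ideal_def
  proof (intro conjI ballI allI)
    show "0 \<in> ?J"
      using is_idealD(1)[OF assms(2)] by (auto intro!: exI[of _ 0])
    show "f1 + f2 \<in> ?J" if f12: "f1 \<in> ?J" "f2 \<in> ?J" for f1 f2
    proof -
      obtain j1 c1 j2 c2 where "j1 \<in> J" "j2 \<in> J" "f1 = j1 + c1 * g" "f2 = j2 + c2 * g"
        using f12 by blast
      then have "f1 + f2 = (j1 + j2) + (c1 + c2) * g" "j1 + j2 \<in> J"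
        using is_idealD(2)[OF assms(2)] by (auto simp: algebra_simps)
      then show ?thesis by blast
    qed
    show "h * f1 \<in> ?J" if f1: "f1 \<in> ?J" for f1 h
    proof -
      obtain j1 c1 where "j1 \<in> J" "f1 = j1 + c1 * g"
        using f1 by blast
      then have "h * f1 = h * j1 + (h * c1) * g" "h * j1 \<in> J"
        using is_idealD(3)[OF assms(2), of j1 h] by (simp_all add: algebra_simps)
      then show ?thesis by blast
    qed
  qed
  moreover have "insert g J \<subseteq> ?J"
  proof
    fix x assume "x \<in> insert g J"
    then consider "x = 0 + 1 * g" | "x \<in> J" "x = x + 0 * g" by auto
    then show "x \<in> ?J"
      using is_idealD(1)[OF assms(2)] by cases blast+
  qed
  ultimately have "f \<in> ?J"
    using assms(1) gen_ideal_least by blast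
  then show ?thesis using that by blast
qed

text \<open>For sums, expand \<open>(f + g) ^ (m + n)\<close>: every term carries \<open>f\<close>
  at least to the power \<open>m\<close> or \<open>g\<close> at least to the power
  \<open>n\<close>.\<close>

lemma radical_is_ideal:
  assumes "is_ideal J"
  shows "is_ideal (radical J)"
proof -
  have "f + g \<in> radical J" if "f ^ m \<in> J" "g ^ n \<in> J" for f g m n
  proof -
    have "of_nat ((m + n) choose k) * f ^ k * g ^ (m + n - k) \<in> J" if "k \<le> m + n" for k
    proof (cases "m \<le> k")
      case True
      then have "f ^ k = f ^ (k - m) * f ^ m"
        by (simp flip: power_add)
      then have "of_nat ((m + n) choose k) * f ^ k * g ^ (m + n - k) =
          (of_nat ((m + n) choose k) * f ^ (k - m) * g ^ (m + n - k)) * f ^ m"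
        by (simp add: ac_simps)
      then show ?thesis
        using is_idealD(3)[OF assms \<open>f ^ m \<in> J\<close>] by simp
    next
      case False
      then have "g ^ (m + n - k) = g ^ (m - k) * g ^ n"
        by (simp flip: power_add)
      then have "of_nat ((m + n) choose k) * f ^ k * g ^ (m + n - k) =
          (of_nat ((m + n) choose k) * f ^ k * g ^ (m - k)) * g ^ n"
        by (simp add: ac_simps)
      then show ?thesis
        using is_idealD(3)[OF assms \<open>g ^ n \<in> J\<close>] by simp
    qed
    then have "(f + g) ^ (m + n) \<in> J"
      unfolding binomial_ring by (intro is_ideal_sum[OF assms]) auto
    then show ?thesis by (auto simp: radical_def)
  qed
  moreover have "h * f \<in> radical J" if "f ^ m \<in> J" for f h m
    using is_idealD(3)[OF assms that, of "h ^ m"]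
    by (auto simp: radical_def power_mult_distrib)
  moreover have "0 \<in> radical J"
    using is_idealD(1)[OF assms] by (auto simp: radical_def intro!: exI[of _ 1])
  ultimately show ?thesis by (auto simp: is_ideal_def radical_def)
qed

subsection \<open>The Hilbert basis theorem\<close>

text \<open>Rings are subsets of one ambient type, so that the tower k, k[x], k[x,y], k[x,y,z] can
  be climbed without changing types.\<close>

definition subring_set :: "'a::comm_ring_1 set \<Rightarrow> bool" where
  "subring_set S \<longleftrightarrow> 0 \<in> S \<and> 1 \<in> S \<and> (\<forall>a\<in>S. - a \<in> S) \<and>
     (\<forall>a\<in>S. \<forall>b\<in>S. a + b \<in> S \<and> a * b \<in> S)"

definition ideal_in :: "'a::comm_ring_1 set \<Rightarrow> 'a set \<Rightarrow> bool" where
  "ideal_in S J \<longleftrightarrow> J \<subseteq> S \<and> 0 \<in> J \<and> (\<forall>f\<in>J. \<forall>g\<in>J. f + g \<in> J) \<and> (\<forall>f\<in>J. \<forall>h\<in>S. h * f \<in> J)"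

definition noetherian :: "'a::comm_ring_1 set \<Rightarrow> bool" where
  "noetherian S \<longleftrightarrow> (\<forall>J::nat \<Rightarrow> 'a set. (\<forall>n. ideal_in S (J n) \<and> J n \<subseteq> J (Suc n)) \<longrightarrow>
     (\<exists>N. \<forall>n\<ge>N. J n = J N))"

text \<open>For a subring \<open>S\<close> this is the ring generated by \<open>S\<close> and
  \<open>t\<close>, where \<open>t\<close> may satisfy algebraic relations over
  \<open>S\<close>.\<close>

definition adjoin :: "'a::comm_ring_1 set \<Rightarrow> 'a \<Rightarrow> 'a set" where
  "adjoin S t = {poly p t | p. \<forall>i. coeff p i \<in> S}"

lemma subring_setD:
  assumes "subring_set S"
  shows "0 \<in> S" "1 \<in> S" "a \<in> S \<Longrightarrow> - a \<in> S"
    "a \<in> S \<Longrightarrow> b \<in> S \<Longrightarrow> a + b \<in> S" "a \<in> S \<Longrightarrow> b \<in> S \<Longrightarrow> a * b \<in> S"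
    "a \<in> S \<Longrightarrow> b \<in> S \<Longrightarrow> a - b \<in> S"
proof -
  show "a \<in> S \<Longrightarrow> b \<in> S \<Longrightarrow> a - b \<in> S"
    using assms unfolding subring_set_def diff_conv_add_uminus by blast
qed (use assms in \<open>auto simp: subring_set_def\<close>)

lemma subring_set_sum:
  "subring_set S \<Longrightarrow> (\<And>i. i \<in> A \<Longrightarrow> f i \<in> S) \<Longrightarrow> sum f A \<in> S"
  by (induction A rule: infinite_finite_induct) (simp_all add: subring_setD)

lemma ideal_inD:
  assumes "ideal_in S J"
  shows "J \<subseteq> S" "0 \<in> J" "f \<in> J \<Longrightarrow> g \<in> J \<Longrightarrow> f + g \<in> J" "f \<in> J \<Longrightarrow> h \<in> S \<Longrightarrow> h * f \<in> J"
  using assms by (auto simp: ideal_in_def)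

lemma noetherianD:
  assumes "noetherian S" "\<And>n. ideal_in S (J n)" "\<And>n. J n \<subseteq> J (Suc n)"
  shows "\<exists>N. \<forall>n\<ge>N. J n = J N"
  using assms(1)[unfolded noetherian_def, rule_format, of J] assms(2,3) by simp

lemma adjoinI: "(\<And>i. coeff p i \<in> S) \<Longrightarrow> poly p t \<in> adjoin S t"
  unfolding adjoin_def by blast

lemma
  assumes "subring_set S"
  shows adjoin_superset: "S \<subseteq> adjoin S t"
    and adjoin_generator: "t \<in> adjoin S t"
    and subring_set_adjoin: "subring_set (adjoin S t)"
proof -
  note S = subring_setD[OF assms]
  show sup: "S \<subseteq> adjoin S t"
  proof
    fix c assume "c \<in> S"
    then show "c \<in> adjoin S t"
      using adjoinI[of "[:c:]" S t] S(1) by (simp add: coeff_pCons split: nat.split)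
  qed
  show "t \<in> adjoin S t"
    using adjoinI[of "[:0, 1:]" S t] S(1,2) by (simp add: coeff_pCons split: nat.split)
  have "- a \<in> adjoin S t" if "a \<in> adjoin S t" for a
  proof -
    obtain p where "a = poly p t" "\<forall>i. coeff p i \<in> S"
      using \<open>a \<in> adjoin S t\<close> unfolding adjoin_def by blast
    then show ?thesis
      using adjoinI[of "- p" S t] S(3) by simp
  qed
  moreover have "a + b \<in> adjoin S t \<and> a * b \<in> adjoin S t"
    if ab: "a \<in> adjoin S t" "b \<in> adjoin S t" for a b
  proof -
    obtain p q where p: "a = poly p t" "\<forall>i. coeff p i \<in> S" and q: "b = poly q t" "\<forall>i. coeff q i \<in> S"
      using ab unfolding adjoin_def by blast
    have "coeff (p * q) i \<in> S" for i
      unfolding coeff_mult using p q S(5) by (intro subring_set_sum[OF assms]) simp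
    moreover have "coeff (p + q) i \<in> S" for i
      using p q S(4) by simp
    ultimately show ?thesis
      using adjoinI[of "p + q" S t] adjoinI[of "p * q" S t] p q by simp
  qed
  ultimately show "subring_set (adjoin S t)"
    using sup S(1,2) unfolding subring_set_def by blast
qed

text \<open>Hilbert's argument: leading coefficients of a chain of ideals form ideals of
  \<open>S\<close>. Once these are stationary in every degree, cancelling leading terms moves
  elements of later ideals into an earlier one.\<close>

theorem noetherian_adjoin:
  fixes S :: "'a::comm_ring_1 set"
  assumes sub: "subring_set S" and noeth: "noetherian S"
  shows "noetherian (adjoin S t)"
  unfolding noetherian_def
proof (intro allI impI)
  fix J :: "nat \<Rightarrow> 'a set"
  assume J: "\<forall>n. ideal_in (adjoin S t) (J n) \<and> J n \<subseteq> J (Suc n)"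
  then have J_ideal: "\<And>n. ideal_in (adjoin S t) (J n)" by blast
  have J_mono: "J m \<subseteq> J n" if "m \<le> n" for m n
    using lift_Suc_mono_le[of J, OF _ that] J by blast
  note S = subring_setD[OF sub]
  \<comment> \<open>Asking only for \<open>degree p \<le> k\<close> allows the coefficient to
    vanish, so that \<open>L n k\<close> is closed under addition.\<close>
  define L where
    "L n k = {coeff p k |p. (\<forall>i. coeff p i \<in> S) \<and> degree p \<le> k \<and> poly p t \<in> J n}" for n k
  have L_ideal: "ideal_in S (L n k)" for n k
    unfolding ideal_in_def
  proof (intro conjI ballI)
    show "L n k \<subseteq> S"
      by (auto simp: L_def)
    show "0 \<in> L n k"
      using S(1) ideal_inD(2)[OF J_ideal] by (auto simp: L_def intro!: exI[of _ 0])
    show "f + g \<in> L n k" if fg: "f \<in> L n k" "g \<in> L n k" for f g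
    proof -
      obtain p q where "\<forall>i. coeff p i \<in> S" "degree p \<le> k" "poly p t \<in> J n" "f = coeff p k"
          "\<forall>i. coeff q i \<in> S" "degree q \<le> k" "poly q t \<in> J n" "g = coeff q k"
        using fg unfolding L_def by blast
      then show ?thesis
        unfolding L_def using S(4) ideal_inD(3)[OF J_ideal]
        by (auto intro!: exI[of _ "p + q"] degree_add_le)
    qed
    show "h * f \<in> L n k" if f: "f \<in> L n k" "h \<in> S" for f h
    proof -
      obtain p where "\<forall>i. coeff p i \<in> S" "degree p \<le> k" "poly p t \<in> J n" "f = coeff p k"
        using f unfolding L_def by blast
      moreover have "h \<in> adjoin S t"
        using \<open>h \<in> S\<close> adjoin_superset[OF sub] by blast
      ultimately show ?thesis
        unfolding L_def using S(5) \<open>h \<in> S\<close> ideal_inD(4)[OF J_ideal]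
        by (auto intro!: exI[of _ "smult h p"] intro: order_trans[OF degree_smult_le])
    qed
  qed
  have L_Suc: "L n k \<subseteq> L n (Suc k)" for n k
  proof
    fix c assume "c \<in> L n k"
    then obtain p where "\<forall>i. coeff p i \<in> S" "degree p \<le> k" "poly p t \<in> J n" "c = coeff p k"
      unfolding L_def by blast
    then show "c \<in> L n (Suc k)"
      unfolding L_def
      using S(1) ideal_inD(4)[OF J_ideal _ adjoin_generator[OF sub]]
      by (auto intro!: exI[of _ "pCons 0 p"] simp: coeff_pCons split: nat.splits
          intro: order_trans[OF degree_pCons_le])
  qed
  have L_mono1: "L m k \<subseteq> L n k" if "m \<le> n" for m n k
    unfolding L_def using J_mono[OF that] by auto
  have L_mono2: "L n k \<subseteq> L n l" if "k \<le> l" for n k l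
    using lift_Suc_mono_le[of "L n", OF _ that] L_Suc by blast
  have L_diag: "L n n \<subseteq> L (Suc n) (Suc n)" for n
    using L_mono1[of n "Suc n" n] L_Suc[of "Suc n" n] by simp
  \<comment> \<open>The diagonal chain settles all \<open>k \<ge> N0\<close> at once. The finitely
    many smaller \<open>k\<close> are treated one by one.\<close>
  obtain N0 where N0: "\<And>n. n \<ge> N0 \<Longrightarrow> L n n = L N0 N0"
    using noetherianD[OF noeth, of "\<lambda>n. L n n", OF L_ideal L_diag] by blast
  have "\<exists>N. \<forall>n\<ge>N. L n k = L N k" for k
  proof -
    have "L n k \<subseteq> L (Suc n) k" for n
      using L_mono1[of n "Suc n" k] by simp
    from noetherianD[OF noeth, of "\<lambda>n. L n k", OF L_ideal this]
    show ?thesis .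
  qed
  then have "\<exists>Nk. \<forall>k. \<forall>n\<ge>Nk k. L n k = L (Nk k) k"
    by (intro choice) blast
  then obtain Nk where Nk: "\<And>k n. n \<ge> Nk k \<Longrightarrow> L n k = L (Nk k) k"
    by blast
  \<comment> \<open>The sum is merely a common upper bound of \<open>N0\<close> and the
    \<open>Nk k\<close> with \<open>k < N0\<close>.\<close>
  define N where "N = N0 + (\<Sum>k<N0. Nk k)"
  have L_stable: "L n k = L N k" if "n \<ge> N" for n k
  proof (cases "k < N0")
    case True
    then have "Nk k \<le> N"
      using member_le_sum[of k "{..<N0}" Nk] by (auto simp: N_def)
    then show ?thesis
      using Nk[of k n] Nk[of k N] that by simp
  next
    case False
    have *: "L n k = L N0 N0" if "n \<ge> N0" for n
    proof
      have "L n k \<subseteq> L (n + k) (n + k)"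
        using L_mono1[of n "n + k" k] L_mono2[of k "n + k" "n + k"] by auto
      then show "L n k \<subseteq> L N0 N0"
        using N0[of "n + k"] that by simp
      show "L N0 N0 \<subseteq> L n k"
        using L_mono1[of N0 n N0] L_mono2[of N0 k n] that False by auto
    qed
    show ?thesis
      using *[of n] *[of N] that by (simp add: N_def)
  qed
  \<comment> \<open>Here \<open>k\<close> is a strict bound on the degree. Each step subtracts some
    \<open>q\<close> with value in \<open>J N\<close> and the same coefficient at the top
    degree.\<close>
  have descend: "poly p t \<in> J N"
    if "n \<ge> N" "\<forall>i. coeff p i \<in> S" "\<forall>i\<ge>k. coeff p i = 0" "poly p t \<in> J n" for n p k
    using that(2-)
  proof (induction k arbitrary: p)
    case 0
    then have "p = 0" by (simp add: poly_eq_iff)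
    then show ?case using ideal_inD(2)[OF J_ideal] by simp
  next
    case (Suc k)
    then have "degree p \<le> k"
      by (intro degree_le) auto
    then have "coeff p k \<in> L n k"
      using Suc.prems by (auto simp: L_def)
    then have "coeff p k \<in> L N k"
      using L_stable[OF \<open>n \<ge> N\<close>] by simp
    then obtain q where q: "\<forall>i. coeff q i \<in> S" "degree q \<le> k" "poly q t \<in> J N"
        "coeff p k = coeff q k"
      unfolding L_def by blast
    have qn: "poly q t \<in> J n"
      using q(3) J_mono[OF \<open>n \<ge> N\<close>] by blast
    have "- 1 \<in> adjoin S t"
      using subring_setD(2,3)[OF subring_set_adjoin[OF sub]] by blast
    then have "- 1 * poly q t \<in> J n"
      using ideal_inD(4)[OF J_ideal qn] by blast
    then have "poly p t + - 1 * poly q t \<in> J n"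
      using ideal_inD(3)[OF J_ideal] Suc.prems by blast
    then have "poly (p - q) t \<in> J n"
      by simp
    moreover have "\<forall>i\<ge>k. coeff (p - q) i = 0"
    proof (intro allI impI)
      fix i assume "k \<le> i"
      show "coeff (p - q) i = 0"
      proof (cases "i = k")
        case True
        then show ?thesis using q(4) by simp
      next
        case False
        then show ?thesis
          using \<open>k \<le> i\<close> q(2) Suc.prems(2) by (simp add: coeff_eq_0)
      qed
    qed
    moreover have "\<forall>i. coeff (p - q) i \<in> S"
      using q(1) Suc.prems(1) S(6) by auto
    ultimately have "poly (p - q) t \<in> J N"
      using Suc.IH by blast
    then have "poly (p - q) t + poly q t \<in> J N"
      using ideal_inD(3)[OF J_ideal] q(3) by blast
    then show ?case by simp
  qed
  have "J n \<subseteq> J N" if "n \<ge> N" for n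
  proof -
    have "g \<in> J N" if "g \<in> J n" for g
    proof -
      obtain p where "g = poly p t" "\<forall>i. coeff p i \<in> S"
        using \<open>g \<in> J n\<close> ideal_inD(1)[OF J_ideal] unfolding adjoin_def by blast
      then show ?thesis
        using \<open>n \<ge> N\<close> \<open>g \<in> J n\<close> descend[of n p "Suc (degree p)"]
        by (simp add: coeff_eq_0)
    qed
    then show ?thesis by blast
  qed
  then show "\<exists>N. \<forall>n\<ge>N. J n = J N"
    using J_mono by blast
qed

subsection \<open>Primary decomposition\<close>

lemma ideal_in_UNIV: "ideal_in UNIV J \<longleftrightarrow> is_ideal J"
  by (auto simp: ideal_in_def is_ideal_def)

text \<open>The ascending chain condition in the form of a well-founded order, for induction in
  which the hypothesis covers all larger ideals.\<close>

lemma wf_ideals: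
  assumes "noetherian (UNIV :: 'a::comm_ring_1 set)"
  shows "wf {(J', J :: 'a set). is_ideal J' \<and> is_ideal J \<and> J \<subset> J'}"
  unfolding wf_iff_no_infinite_down_chain
proof
  assume "\<exists>f. \<forall>i. (f (Suc i), f i) \<in> {(J', J :: 'a set). is_ideal J' \<and> is_ideal J \<and> J \<subset> J'}"
  then obtain f :: "nat \<Rightarrow> 'a set" where f: "\<And>i. is_ideal (f i)" "\<And>i. f i \<subset> f (Suc i)"
    by blast
  then obtain N where N: "\<And>n. n \<ge> N \<Longrightarrow> f n = f N"
    using noetherianD[OF assms, of f, unfolded ideal_in_UNIV] by blast
  show False
    using f(2)[of N] N[of "Suc N"] by simp
qed

text \<open>Noether's argument that irreducible ideals are primary: if \<open>f * g\<close>
  witnesses the failure, the colon ideals \<open>I : g^n\<close> stop growing at some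
  \<open>N\<close>, and \<open>I\<close> is the intersection of \<open>I + (g^N)\<close> and
  \<open>I + (f)\<close>.\<close>

lemma ideal_splitting:
  assumes noeth: "noetherian (UNIV :: 'a::comm_ring_1 set)"
    and I: "is_ideal (I :: 'a set)" "I \<noteq> UNIV" "\<not> primary_ideal I"
  obtains J1 J2 where "is_ideal J1" "is_ideal J2" "I \<subset> J1" "I \<subset> J2" "I = J1 \<inter> J2"
proof -
  obtain f g where fg: "f * g \<in> I" "f \<notin> I" "g \<notin> radical I"
    using I unfolding primary_ideal_def by blast
  define C where "C n = {h. g ^ n * h \<in> I}" for n
  have C_ideal: "is_ideal (C n)" for n
    unfolding is_ideal_def C_def using is_idealD[OF I(1)]
    by (auto simp: distrib_left mult.left_commute)
  have C_Suc: "C n \<subseteq> C (Suc n)" for n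
    unfolding C_def using is_idealD(3)[OF I(1)] by (auto simp: mult.assoc)
  obtain N where N: "\<And>n. n \<ge> N \<Longrightarrow> C n = C N"
    using noetherianD[OF noeth, of C, unfolded ideal_in_UNIV, OF C_ideal C_Suc] by blast
  define J1 where "J1 = gen_ideal (insert (g ^ N) I)"
  define J2 where "J2 = gen_ideal (insert f I)"
  have sub: "I \<subseteq> J1" "I \<subseteq> J2"
    unfolding J1_def J2_def by (auto intro: gen_ideal_superset)
  have "g ^ N \<in> J1" "g ^ N \<notin> I" "f \<in> J2"
    using fg by (auto simp: J1_def J2_def radical_def intro: gen_ideal_superset)
  then have "I \<subset> J1" "I \<subset> J2"
    using sub fg by auto
  moreover have "h \<in> I" if h: "h \<in> J1" "h \<in> J2" for h
  proof -
    obtain c1 j1 where 1: "j1 \<in> I" "h = j1 + c1 * g ^ N"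
      using gen_ideal_insertE[OF h(1)[unfolded J1_def] I(1)] by metis
    obtain c2 j2 where 2: "j2 \<in> I" "h = j2 + c2 * f"
      using gen_ideal_insertE[OF h(2)[unfolded J2_def] I(1)] by metis
    \<comment> \<open>The second representation of \<open>h\<close> gives
      \<open>g * h \<in> I\<close>. The first then yields \<open>g ^ Suc N * c1 \<in> I\<close>, and
      stationarity lowers the exponent to \<open>N\<close>.\<close>
    have "g * h = g * j2 + c2 * (f * g)"
      unfolding 2(2) by (simp add: algebra_simps)
    then have "g * h \<in> I"
      using 2(1) fg(1) is_idealD[OF I(1)] by simp
    moreover have "g * h - g * j1 = g ^ Suc N * c1"
      unfolding 1(2) by (simp add: algebra_simps)
    ultimately have "g ^ Suc N * c1 \<in> I"
      using 1(1) is_ideal_diff[OF I(1)] is_idealD(3)[OF I(1)] by metis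
    then have "c1 \<in> C N"
      using N[of "Suc N"] by (auto simp: C_def)
    then show ?thesis
      using 1 is_idealD(2)[OF I(1)] by (auto simp: C_def mult.commute)
  qed
  ultimately show ?thesis
    using that[of J1 J2] sub gen_ideal_is_ideal unfolding J1_def J2_def by blast
qed

theorem primary_decomposition_exists:
  assumes noeth: "noetherian (UNIV :: 'a::comm_ring_1 set)"
    and I: "is_ideal (I :: 'a set)"
  shows "\<exists>Qs. (\<forall>Q\<in>set Qs. primary_ideal Q) \<and> I = \<Inter>(set Qs)"
  using wf_ideals[OF noeth] I
proof (induction I rule: wf_induct_rule)
  case (less I)
  consider "I = UNIV" | "primary_ideal I" | "I \<noteq> UNIV" "\<not> primary_ideal I" by blast
  then show ?case
  proof cases
    case 1
    \<comment> \<open>The whole ring is the empty intersection.\<close>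
    then show ?thesis by (intro exI[of _ "[]"]) auto
  next
    case 2
    then show ?thesis by (intro exI[of _ "[I]"]) auto
  next
    case 3
    obtain J1 J2 where J: "is_ideal J1" "is_ideal J2" "I \<subset> J1" "I \<subset> J2" "I = J1 \<inter> J2"
      using ideal_splitting[OF noeth less.prems 3] by blast
    obtain Q1 Q2 where "\<forall>Q\<in>set Q1. primary_ideal Q" "J1 = \<Inter>(set Q1)"
        "\<forall>Q\<in>set Q2. primary_ideal Q" "J2 = \<Inter>(set Q2)"
      using less.IH[of J1] less.IH[of J2] J less.prems by auto
    then show ?thesis
      using J by (intro exI[of _ "Q1 @ Q2"]) auto
  qed
qed

text \<open>Every primary ideal over \<open>I\<close> with radical \<open>P\<close> contains \<open>Q\<close>, so the components of \<open>I\<close>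
  with radical \<open>P\<close> may be traded for \<open>Q\<close>.\<close>

lemma is_primary_componentI:
  assumes noeth: "noetherian (UNIV :: 'a::comm_ring_1 set)"
    and I: "is_ideal (I :: 'a set)"
    and Q: "primary_ideal Q" "radical Q = P" "I \<subseteq> Q"
    and loc: "\<And>f. f \<in> Q \<Longrightarrow> \<exists>h. h \<notin> P \<and> h * f \<in> I"
  shows "is_primary_component I P Q"
proof -
  obtain Qs where Qs: "\<forall>Q\<in>set Qs. primary_ideal Q" "I = \<Inter>(set Qs)"
    using primary_decomposition_exists[OF noeth I] by blast
  have "Q \<subseteq> Q'" if "Q' \<in> set Qs" "radical Q' = P" for Q'
  proof
    fix f assume "f \<in> Q"
    then obtain h where "h \<notin> P" "h * f \<in> I"
      using loc by blast
    then have "f * h \<in> Q'" "h \<notin> radical Q'"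
      using that Qs(2) by (auto simp: mult.commute)
    then show "f \<in> Q'"
      using Qs(1) that(1) by (auto simp: primary_ideal_def)
  qed
  then have "I = Q \<inter> \<Inter>(set (filter (\<lambda>Q'. radical Q' \<noteq> P) Qs))"
    using Qs(2) Q(3) by auto
  then show ?thesis
    unfolding is_primary_component_def using Q(1,2) Qs(1)
    by (intro conjI exI[of _ "filter (\<lambda>Q'. radical Q' \<noteq> P) Qs"]) auto
qed

subsection \<open>Polynomials in three variables\<close>

abbreviation mon :: "nat \<Rightarrow> nat \<Rightarrow> nat \<Rightarrow> 'k::comm_ring_1 \<Rightarrow> 'k mpoly3" where
  "mon i j l c \<equiv> Poly_Mapping.single (i, j, l) c"

lemma sum_single_lookup:
  "(\<Sum>m\<in>Poly_Mapping.keys f. Poly_Mapping.single m (Poly_Mapping.lookup f m)) = f"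
  by (rule poly_mapping_eqI)
    (simp add: lookup_sum lookup_single when_def in_keys_iff sum.delta)

lemma mpoly3_induct [case_names add mon]:
  assumes "\<And>f g. P f \<Longrightarrow> P g \<Longrightarrow> P (f + g)" "\<And>i j l c. P (mon i j l c)"
  shows "P (f :: 'k::comm_ring_1 mpoly3)"
proof -
  have "P (\<Sum>m\<in>A. Poly_Mapping.single m (Poly_Mapping.lookup f m))" if "finite A" for A
    using that
  proof (induction A rule: finite_induct)
    case empty
    show ?case using assms(2)[of 0 0 0 0] by simp
  next
    case (insert m A)
    then show ?case using assms(1) assms(2) by (cases m) simp
  qed
  from this[of "Poly_Mapping.keys f"] show ?thesis
    by (simp add: sum_single_lookup)
qed

lemma varX_power: "varX ^ n = mon n 0 0 1"
  by (induction n) (simp_all add: varX_def mult_single flip: single_one zero_prod_def)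

lemma varY_power: "varY ^ n = mon 0 n 0 1"
  by (induction n) (simp_all add: varY_def mult_single flip: single_one zero_prod_def)

lemma varZ_power: "varZ ^ n = mon 0 0 n 1"
  by (induction n) (simp_all add: varZ_def mult_single flip: single_one zero_prod_def)

section \<open>The ring k[x,y,z] is Noetherian\<close>

lemma subring_set_UNIV_mpoly3:
  fixes T :: "'k::comm_ring_1 mpoly3 set"
  assumes "subring_set T" "range (Poly_Mapping.single 0) \<subseteq> T" "varX \<in> T" "varY \<in> T" "varZ \<in> T"
  shows "T = UNIV"
proof -
  note T = subring_setD[OF assms(1)]
  have pow: "g ^ n \<in> T" if "g \<in> T" for g n
    using that by (induction n) (auto intro: T(2,5))
  have "f \<in> T" for f
  proof (induction f rule: mpoly3_induct)
    case (add f g)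
    then show ?case by (rule T(4))
  next
    case (mon i j l c)
    have "mon i j l c = Poly_Mapping.single 0 c * (varX ^ i * (varY ^ j * varZ ^ l))"
      unfolding varX_power varY_power varZ_power by (simp add: mult_single)
    moreover have "Poly_Mapping.single 0 c \<in> T"
      using assms(2) by blast
    ultimately show ?case
      using T(5) pow assms(3-5) by simp
  qed
  then show ?thesis by blast
qed

text \<open>A field has only two ideals, so an increasing chain changes at most once.\<close>

lemma noetherian_constants:
  "noetherian (range (Poly_Mapping.single 0) :: 'k::field mpoly3 set)"
  (is "noetherian ?S")
  unfolding noetherian_def
proof (intro allI impI)
  fix J :: "nat \<Rightarrow> 'k mpoly3 set"
  assume J: "\<forall>n. ideal_in ?S (J n) \<and> J n \<subseteq> J (Suc n)"
  have full: "J n = ?S" if nz: "J n \<noteq> {0}" for n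
  proof -
    have Jn: "ideal_in ?S (J n)" using J by blast
    obtain c where c: "Poly_Mapping.single 0 c \<in> J n" "c \<noteq> 0"
      using nz ideal_inD(1,2)[OF Jn] by fastforce
    have "Poly_Mapping.single 0 x \<in> J n" for x
      using ideal_inD(4)[OF Jn c(1), of "Poly_Mapping.single 0 (x / c)"] c(2)
      by (simp add: mult_single)
    then show ?thesis using ideal_inD(1)[OF Jn] by blast
  qed
  show "\<exists>N. \<forall>n\<ge>N. J n = J N"
  proof (cases "\<exists>N. J N \<noteq> {0}")
    case True
    then obtain N where N: "J N \<noteq> {0}" by blast
    have "J n = J N" if "N \<le> n" for n
    proof -
      have "J N \<subseteq> J n"
        using lift_Suc_mono_le[of J, OF _ that] J by blast
      moreover have "0 \<in> J N"
        using ideal_inD(2)[of ?S "J N"] J by blast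
      ultimately have "J n \<noteq> {0}"
        using N by blast
      then show ?thesis
        using full[of n] full[OF N] by simp
    qed
    then show ?thesis by blast
  next
    case False
    then show ?thesis by simp
  qed
qed

lemma subring_set_constants: "subring_set (range (Poly_Mapping.single 0) :: 'k::comm_ring_1 mpoly3 set)"
  unfolding subring_set_def
proof (intro conjI ballI)
  show "0 \<in> range (Poly_Mapping.single 0 :: 'k \<Rightarrow> 'k mpoly3)"
    by (rule range_eqI[of _ _ 0]) simp
  show "1 \<in> range (Poly_Mapping.single 0 :: 'k \<Rightarrow> 'k mpoly3)"
    by (rule range_eqI[of _ _ 1]) simp
qed (auto simp: mult_single simp flip: single_add single_uminus)

theorem noetherian_mpoly3: "noetherian (UNIV :: 'k::field mpoly3 set)"
proof -
  define S0 where "S0 = (range (Poly_Mapping.single 0) :: 'k mpoly3 set)"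
  define S1 where "S1 = adjoin S0 varX"
  define S2 where "S2 = adjoin S1 varY"
  define S3 where "S3 = adjoin S2 varZ"
  note sub0 = subring_set_constants[where 'k='k, folded S0_def]
  note sub1 = subring_set_adjoin[OF sub0, of varX, folded S1_def]
  note sub2 = subring_set_adjoin[OF sub1, of varY, folded S2_def]
  note sub3 = subring_set_adjoin[OF sub2, of varZ, folded S3_def]
  have "noetherian S0" unfolding S0_def by (rule noetherian_constants)
  then have "noetherian S1" unfolding S1_def by (rule noetherian_adjoin[OF sub0])
  then have "noetherian S2" unfolding S2_def by (rule noetherian_adjoin[OF sub1])
  then have "noetherian S3" unfolding S3_def by (rule noetherian_adjoin[OF sub2])
  moreover have "S3 = UNIV"
    using adjoin_superset[OF sub0, of varX, folded S1_def] adjoin_generator[OF sub0, of varX, folded S1_def]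
      adjoin_superset[OF sub1, of varY, folded S2_def] adjoin_generator[OF sub1, of varY, folded S2_def]
      adjoin_superset[OF sub2, of varZ, folded S3_def] adjoin_generator[OF sub2, of varZ, folded S3_def]
    by (intro subring_set_UNIV_mpoly3[OF sub3]) (auto simp: S0_def)
  ultimately show ?thesis by simp
qed

section \<open>Additive and \<open>k[z]\<close>-linear maps given on monomials\<close>

definition lin :: "(nat \<Rightarrow> nat \<Rightarrow> nat \<Rightarrow> 'k \<Rightarrow> 'b::comm_monoid_add) \<Rightarrow> 'k::comm_ring_1 mpoly3 \<Rightarrow> 'b" where
  "lin g f = (\<Sum>m\<in>Poly_Mapping.keys f. g (fst m) (fst (snd m)) (snd (snd m)) (Poly_Mapping.lookup f m))"

lemma lin_mon: "g i j l 0 = 0 \<Longrightarrow> lin g (mon i j l c) = g i j l c"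
  by (simp add: lin_def)

lemma lin_add:
  assumes "\<And>i j l. g i j l 0 = 0" "\<And>i j l b c. g i j l (b + c) = g i j l b + g i j l c"
  shows "lin g (f1 + f2) = lin g f1 + lin g f2"
  unfolding lin_def by (rule setsum_keys_plus_distrib) (use assms in auto)

text \<open>\<open>weigh w S\<close> is the \<open>k[z]\<close>-linear map to \<open>k[z]\<close> sending \<open>x^i y^j\<close> to \<open>z^w(i,j)\<close> for
  \<open>(i,j) \<in> S\<close> and to \<open>0\<close> otherwise.\<close>

definition weigh :: "(nat \<times> nat \<Rightarrow> nat) \<Rightarrow> (nat \<times> nat) set \<Rightarrow> 'k::comm_ring_1 mpoly3 \<Rightarrow> 'k poly" where
  "weigh w S = lin (\<lambda>i j l c. if (i, j) \<in> S then monom c (l + w (i, j)) else 0)"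

definition restrict_xy :: "(nat \<times> nat) set \<Rightarrow> 'k::comm_ring_1 mpoly3 \<Rightarrow> 'k mpoly3" where
  "restrict_xy S = lin (\<lambda>i j l c. if (i, j) \<in> S then mon i j l c else 0)"

lemma weigh_mon: "weigh w S (mon i j l c) = (if (i, j) \<in> S then monom c (l + w (i, j)) else 0)"
  unfolding weigh_def by (simp add: lin_mon)

lemma weigh_add: "weigh w S (f + g) = weigh w S f + weigh w S g"
  unfolding weigh_def by (rule lin_add) (auto simp: add_monom)

lemma weigh_0 [simp]: "weigh w S 0 = 0"
  by (simp add: weigh_def lin_def)

lemma weigh_diff: "weigh w S (f - g) = weigh w S f - weigh w S g"
  using weigh_add[of w S "f - g" g] by (simp add: algebra_simps)

lemma restrict_xy_mon: "restrict_xy S (mon i j l c) = (if (i, j) \<in> S then mon i j l c else 0)"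
  unfolding restrict_xy_def by (simp add: lin_mon)

lemma restrict_xy_add: "restrict_xy S (f + g) = restrict_xy S f + restrict_xy S g"
  unfolding restrict_xy_def by (rule lin_add) (auto simp: single_add)

text \<open>The embedding of k[z] into k[x,y,z].\<close>

definition poly_z :: "'k::comm_ring_1 poly \<Rightarrow> 'k mpoly3" where
  "poly_z p = (\<Sum>l\<le>degree p. mon 0 0 l (coeff p l))"

lemma poly_z_alt: "degree p \<le> n \<Longrightarrow> poly_z p = (\<Sum>l\<le>n. mon 0 0 l (coeff p l))"
  unfolding poly_z_def by (intro sum.mono_neutral_left) (auto simp: coeff_eq_0)

lemma poly_z_add: "poly_z (p + q) = poly_z p + poly_z q"
proof -
  define n where "n = max (degree p) (degree q)"
  have "degree (p + q) \<le> n" "degree p \<le> n" "degree q \<le> n"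
    by (auto simp: n_def degree_add_le_max)
  then show ?thesis
    by (simp add: poly_z_alt single_add sum.distrib)
qed

lemma poly_z_0 [simp]: "poly_z 0 = 0"
  by (simp add: poly_z_def)

lemma poly_z_monom: "poly_z (monom c l) = mon 0 0 l c"
proof -
  have "poly_z (monom c l) = (\<Sum>k\<le>l. mon 0 0 k (coeff (monom c l) k))"
    by (rule poly_z_alt) (rule degree_monom_le)
  also have "\<dots> = (\<Sum>k\<le>l. if k = l then mon 0 0 l c else 0)"
    by (intro sum.cong) auto
  finally show ?thesis by simp
qed

lemma weigh_mon_mult: "weigh w S (mon 0 0 l c * f) = monom c l * weigh w S f"
  by (induction f rule: mpoly3_induct)
    (auto simp: distrib_left weigh_add weigh_mon mult_single mult_monom add.assoc)

text \<open>This is \<open>k[z]\<close>-linearity. Over a field the values lie in a domain, so the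
  kernel of \<open>weigh\<close> is closed under division by nonzero polynomials in z.\<close>

lemma weigh_poly_z_mult: "weigh w S (poly_z p * f) = p * weigh w S f"
proof -
  have "weigh w S ((\<Sum>l\<in>A. mon 0 0 l (coeff p l)) * f) = (\<Sum>l\<in>A. monom (coeff p l) l) * weigh w S f"
    if "finite A" for A
    using that
    by (induction A rule: finite_induct) (simp_all add: distrib_right weigh_add weigh_mon_mult)
  from this[of "{..degree p}"] show ?thesis
    unfolding poly_z_def by (simp add: poly_as_sum_of_monoms)
qed

lemma weigh_poly_z_power_mult: "weigh w S (poly_z p ^ n * f) = p ^ n * weigh w S f"
  by (induction n) (simp_all add: mult.assoc weigh_poly_z_mult)

text \<open>The substitution x = y = 0, a ring homomorphism onto k[z].\<close>

definition at_xy0 :: "'k::comm_ring_1 mpoly3 \<Rightarrow> 'k poly" where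
  "at_xy0 = weigh (\<lambda>_. 0) {(0, 0)}"

lemma at_xy0_mon: "at_xy0 (mon i j l c) = (if i = 0 \<and> j = 0 then monom c l else 0)"
  by (simp add: at_xy0_def weigh_mon)

lemma at_xy0_add: "at_xy0 (f + g) = at_xy0 f + at_xy0 g"
  by (simp add: at_xy0_def weigh_add)

lemma at_xy0_diff: "at_xy0 (f - g) = at_xy0 f - at_xy0 g"
  by (simp add: at_xy0_def weigh_diff)

lemma at_xy0_0 [simp]: "at_xy0 0 = 0"
  by (simp add: at_xy0_def)

lemma at_xy0_mult: "at_xy0 (f * g) = at_xy0 f * at_xy0 g"
proof (induction f rule: mpoly3_induct)
  case (add f f')
  then show ?case by (simp add: distrib_right at_xy0_add)
next
  case (mon i j l c)
  show ?case
    by (induction g rule: mpoly3_induct)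
      (auto simp: distrib_left at_xy0_add at_xy0_mon mult_single mult_monom)
qed

lemma at_xy0_1 [simp]: "at_xy0 1 = 1"
  using at_xy0_mon[of 0 0 0 1] by (simp flip: zero_prod_def)

lemma at_xy0_power: "at_xy0 (f ^ n) = at_xy0 f ^ n"
  by (induction n) (simp_all add: at_xy0_mult)

lemma diff_poly_z_at_xy0: "f - poly_z (at_xy0 f) \<in> gen_ideal {varX, varY}"
proof (induction f rule: mpoly3_induct)
  case (add f g)
  then show ?case
    using is_idealD(2)[OF gen_ideal_is_ideal add] by (simp add: at_xy0_add poly_z_add algebra_simps)
next
  case (mon i j l c)
  consider "i = 0" "j = 0" | i' where "i = Suc i'" | j' where "j = Suc j'"
    by (cases i; cases j) auto
  then show ?case
  proof cases
    case 1
    then show ?thesis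
      using is_idealD(1)[OF gen_ideal_is_ideal] by (simp add: at_xy0_mon poly_z_monom)
  next
    case 2
    then have eq: "mon i j l c = mon i' j l c * varX"
      by (simp add: varX_def mult_single)
    then show ?thesis
      using is_idealD(3)[OF gen_ideal_is_ideal gen_ideal_superset, of varX "{varX, varY}" "mon i' j l c"] 2
      by (simp add: at_xy0_mon flip: eq)
  next
    case 3
    then have eq: "mon i j l c = mon i j' l c * varY"
      by (simp add: varY_def mult_single)
    then show ?thesis
      using is_idealD(3)[OF gen_ideal_is_ideal gen_ideal_superset, of varY "{varX, varY}" "mon i j' l c"] 3
      by (simp add: at_xy0_mon flip: eq)
  qed
qed

text \<open>With the prime ideal written as a kernel, lying outside it becomes a nonvanishing
  condition in k[z].\<close>

lemma gen_ideal_xy: "gen_ideal {varX, varY} = {f. at_xy0 f = 0}"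
proof
  have "is_ideal {f. at_xy0 f = 0}"
    by (simp add: is_ideal_def at_xy0_add at_xy0_mult)
  moreover have "{varX, varY} \<subseteq> {f. at_xy0 f = 0}"
    by (simp add: varX_def varY_def at_xy0_mon)
  ultimately show "gen_ideal {varX, varY} \<subseteq> {f. at_xy0 f = 0}"
    by (rule gen_ideal_least)
  show "{f. at_xy0 f = 0} \<subseteq> gen_ideal {varX, varY}"
    using diff_poly_z_at_xy0 by (metis (mono_tags) diff_zero mem_Collect_eq poly_z_0 subsetI)
qed

text \<open>Meant for sets \<open>K\<close> cut out by maps that are only
  \<open>k[z]\<close>-linear: being an ideal is not evident for them, but term multiples of
  generators can be checked directly.\<close>

lemma gen_ideal_subset_additive:
  fixes K :: "'k::comm_ring_1 mpoly3 set"
  assumes "0 \<in> K" "\<And>f g. f \<in> K \<Longrightarrow> g \<in> K \<Longrightarrow> f + g \<in> K"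
    and gens: "\<And>g i j l c. g \<in> S \<Longrightarrow> mon i j l c * g \<in> K"
  shows "gen_ideal S \<subseteq> K"
proof
  fix f assume "f \<in> gen_ideal S"
  then obtain F c where F: "f = (\<Sum>g\<in>F. c g * g)" "finite F" "F \<subseteq> S"
    unfolding gen_ideal_def by blast
  have mult: "h * g \<in> K" if "g \<in> S" for g h
    by (induction h rule: mpoly3_induct)
      (use assms(2) gens[OF that] in \<open>auto simp: distrib_right\<close>)
  show "f \<in> K"
    unfolding F(1) using F(2,3)
    by (induction F rule: finite_induct) (auto intro: assms(1,2) mult)
qed

text \<open>If all monomials in \<open>S\<close> are proportional to one of them up to powers of z,
  the part of \<open>f\<close> supported on \<open>S\<close> collapses to a
  \<open>k[z]\<close>-multiple of that monomial, and \<open>weigh\<close> computes the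
  factor.\<close>

lemma restrict_xy_congruent:
  fixes J :: "'k::comm_ring_1 mpoly3 set"
  assumes J: "is_ideal J"
    and S: "\<And>i j. (i, j) \<in> S \<Longrightarrow> mon i j t 1 - mon i0 j0 (w (i, j)) 1 \<in> J"
  shows "varZ ^ t * restrict_xy S f - poly_z (weigh w S f) * mon i0 j0 0 1 \<in> J"
proof (induction f rule: mpoly3_induct)
  case (add f g)
  then show ?case
    using is_idealD(2)[OF J add] by (simp add: restrict_xy_add weigh_add poly_z_add algebra_simps)
next
  case (mon i j l c)
  show ?case
  proof (cases "(i, j) \<in> S")
    case True
    then show ?thesis
      using is_idealD(3)[OF J S[OF True], of "mon 0 0 l c"]
      by (simp add: restrict_xy_mon weigh_mon poly_z_monom varZ_power mult_single
          right_diff_distrib add.commute)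
  next
    case False
    then show ?thesis
      using is_idealD(1)[OF J] by (simp add: restrict_xy_mon weigh_mon)
  qed
qed

lemma restrict_xy_conv_sum:
  "restrict_xy S f = (\<Sum>m | m \<in> Poly_Mapping.keys f \<and> (fst m, fst (snd m)) \<in> S.
     Poly_Mapping.single m (Poly_Mapping.lookup f m))"
  unfolding restrict_xy_def lin_def by (subst sum.inter_filter[symmetric]) auto

subsection \<open>Saturation\<close>

lemma saturation_is_ideal:
  assumes "is_ideal I"
  shows "is_ideal (saturation I z)"
proof -
  have "f + g \<in> saturation I z" if "z ^ m * f \<in> I" "z ^ n * g \<in> I" for f g m n
  proof -
    have "z ^ (m + n) * (f + g) = z ^ n * (z ^ m * f) + z ^ m * (z ^ n * g)"
      by (simp add: power_add algebra_simps)
    then have "z ^ (m + n) * (f + g) \<in> I"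
      using is_idealD(2,3)[OF assms] that by simp
    then show ?thesis unfolding saturation_def by blast
  qed
  moreover have "h * f \<in> saturation I z" if "z ^ m * f \<in> I" for f h m
    using is_idealD(3)[OF assms that, of h] unfolding saturation_def
    by (auto simp: mult.left_commute)
  moreover have "0 \<in> saturation I z"
    unfolding saturation_def using is_idealD(1)[OF assms] by simp
  ultimately show ?thesis unfolding is_ideal_def saturation_def by blast
qed

lemma saturation_superset: "I \<subseteq> saturation I z"
  unfolding saturation_def by (auto intro: exI[of _ 0])

lemma saturation_cancel: "z ^ n * f \<in> saturation I z \<Longrightarrow> f \<in> saturation I z"
  unfolding saturation_def by (auto simp flip: mult.assoc power_add)

subsection \<open>The potential\<close>

text \<open>Modulo \<open>n = r + s\<close>, adding \<open>r\<close> and adding \<open>s\<close> are inverse to each other, so sorting the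
  nonzero residues \<open>i + 1\<close> by \<open>(i + 1) / r mod n\<close> turns the graph on \<open>{0..n-2}\<close> with edges
  \<open>{i, i + r}\<close> and \<open>{i, i + s}\<close> into a path.  Being a tree, it carries a potential with
  prescribed increments.\<close>

lemma potential_exists:
  fixes r s a b :: nat
  assumes "coprime r s" "0 < r" "0 < s"
  shows "\<exists>\<psi>::nat \<Rightarrow> nat. (\<forall>i. Suc (i + r) < r + s \<longrightarrow> \<psi> i = \<psi> (i + r) + a) \<and>
    (\<forall>i. Suc (i + s) < r + s \<longrightarrow> \<psi> i = \<psi> (i + s) + b)"
proof -
  define n where "n = r + s"
  have n: "r < n" "s < n" "0 < n" using assms by (auto simp: n_def)
  have "coprime r n" using assms(1) by (simp add: n_def coprime_iff_gcd_eq_1)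
  then obtain x where x: "[r * x = Suc 0] (mod n)"
    using cong_solve_coprime_nat by blast
  \<comment> \<open>\<open>\<tau> i\<close> is the position of vertex \<open>i\<close> on the path:
    the solution of \<open>r * \<tau> i = i + 1\<close> modulo \<open>n\<close>.\<close>
  define \<tau> where "\<tau> i = (x * Suc i) mod n" for i
  define q where "q i = (r * \<tau> i) div n" for i
  \<comment> \<open>\<open>q i\<close> counts the wraps past \<open>n\<close>, that is, the
    \<open>s\<close>-links used so far. The summand \<open>n\<close> keeps the subtraction from
    truncating, as \<open>\<tau> i < n\<close>.\<close>
  define \<psi> where "\<psi> i = b * q i + a * (n + q i - \<tau> i)" for i
  have \<tau>_less: "\<tau> i < n" for i
    using n by (simp add: \<tau>_def)
  have r\<tau>: "[r * \<tau> i = Suc i] (mod n)" for i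
  proof -
    have "[r * \<tau> i = (r * x) * Suc i] (mod n)"
      by (simp add: cong_def \<tau>_def mod_mult_right_eq mult.assoc del: mult_Suc_right)
    also have "[(r * x) * Suc i = Suc 0 * Suc i] (mod n)"
      by (rule cong_mult[OF x cong_refl])
    finally show ?thesis by simp
  qed
  have r\<tau>_div: "r * \<tau> i = n * q i + Suc i" if "Suc i < n" for i
    using r\<tau>[of i] that div_mult_mod_eq[of "r * \<tau> i" n] by (simp add: cong_def q_def mult.commute)
  have \<tau>_pos: "0 < \<tau> i" if "Suc i < n" for i
    using r\<tau>_div[OF that] by (cases "\<tau> i") auto
  have \<tau>_unique: "\<tau> i = \<tau>'" if "[r * \<tau>' = Suc i] (mod n)" "\<tau>' < n" for i \<tau>'
  proof -
    have "[r * \<tau> i = r * \<tau>'] (mod n)"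
      using r\<tau>[of i] that(1) by (metis cong_sym cong_trans)
    then have "[\<tau> i = \<tau>'] (mod n)"
      using \<open>coprime r n\<close> cong_mult_lcancel_nat by blast
    then show ?thesis
      using \<tau>_less that(2) cong_less_modulus_unique_nat by blast
  qed
  have step: "\<tau> j = Suc (\<tau> i)"
    if "Suc i < n" "Suc j < n" "[j = i + r] (mod n)" for i j
  proof -
    have c: "[r * Suc (\<tau> i) = Suc j] (mod n)"
      using cong_add[OF r\<tau>[of i] cong_refl[of r]] cong_add[OF cong_sym[OF that(3)] cong_refl[of 1]]
      by (auto simp: add.commute intro: cong_trans)
    \<comment> \<open>The path would otherwise reach the residue \<open>0\<close>, which is not of
      the form \<open>j + 1\<close> for a vertex \<open>j\<close>.\<close>
    have "Suc (\<tau> i) \<noteq> n"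
    proof
      assume "Suc (\<tau> i) = n"
      then have "[Suc j = 0] (mod n)"
        using c cong_mult_self_right[of r n] by (metis cong_sym cong_trans)
      then show False using that(2) by (simp add: cong_def)
    qed
    then show ?thesis
      using \<tau>_unique[OF c] \<tau>_less[of i] by simp
  qed
  have "\<psi> i = \<psi> (i + r) + a" if "Suc (i + r) < n" for i
  proof -
    have t: "\<tau> (i + r) = Suc (\<tau> i)"
      using step[of i "i + r"] that by simp
    have "n * q i + Suc (i + r) = n * q (i + r) + Suc (i + r)"
      using r\<tau>_div[of i] r\<tau>_div[of "i + r"] that t by simp
    then have "q (i + r) = q i" using n by simp
    moreover have "n + q i - \<tau> i = Suc (n + q i - Suc (\<tau> i))"
      using \<tau>_less[of i] by simp
    ultimately show ?thesis
      unfolding \<psi>_def t by simp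
  qed
  moreover have "\<psi> i = \<psi> (i + s) + b" if "Suc (i + s) < n" for i
  proof -
    have "i + s + r = i + n" by (simp add: n_def)
    then have "[i = i + s + r] (mod n)" unfolding cong_def by (simp only: mod_add_self2)
    then have t: "\<tau> i = Suc (\<tau> (i + s))"
      using step[of "i + s" i] that by simp
    \<comment> \<open>Going from \<open>i + s\<close> to \<open>i\<close> raises both
      \<open>\<tau>\<close> and \<open>q\<close> by one, so the multiples of \<open>a\<close> cancel
      and only \<open>b\<close> remains.\<close>
    have "n * q i + Suc i = n * q (i + s) + Suc (i + s) + r"
      using r\<tau>_div[of i] r\<tau>_div[of "i + s"] that t by simp
    then have "n * q i = n * Suc (q (i + s))"
      by (simp add: n_def algebra_simps)
    then have "q i = Suc (q (i + s))" using n by (metis mult_cancel1 less_numeral_extra(3))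
    then show ?thesis
      unfolding \<psi>_def t by simp
  qed
  ultimately show ?thesis
    unfolding n_def by blast
qed

subsection \<open>The primary component\<close>

text \<open>With \<open>u = x^d\<close> and \<open>v = y^e\<close>, the generators become \<open>u^r z^a - v^r\<close> and
  \<open>u^s z^b - v^s\<close>; the exponents \<open>r\<close>, \<open>s\<close> of this locale are those of the theorem divided by
  \<open>d = gcd r s\<close>, and \<open>e = \<lambda> d\<close>.\<close>

locale binomial_pair =
  fixes r s a b d e :: nat and \<psi> :: "nat \<Rightarrow> nat" and I :: "'k::field mpoly3 set"
  assumes pos: "0 < r" "0 < s" "0 < d" "0 < e"
    and rank: "b * r \<noteq> a * s"
    and I_def: "I = gen_ideal {mon (d * r) 0 a 1 - mon 0 (e * r) 0 1,
                               mon (d * s) 0 b 1 - mon 0 (e * s) 0 1}"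
    and \<psi>_r: "\<And>i. Suc (i + r) < r + s \<Longrightarrow> \<psi> i = \<psi> (i + r) + a"
    and \<psi>_s: "\<And>i. Suc (i + s) < r + s \<Longrightarrow> \<psi> i = \<psi> (i + s) + b"
begin

text \<open>Degree below \<open>r + s - 1\<close> in u and v. Since k[x,y] is free over k[u,v] on
  the monomials with x-exponent below \<open>d\<close> and y-exponent below \<open>e\<close>,
  integer division reads off the exponents of u and v.\<close>

definition low :: "(nat \<times> nat) set" where
  "low = {(i, j). Suc (i div d + j div e) < r + s}"

text \<open>One potential serves all low degrees, since links in degree k only involve u-exponents
  up to k.\<close>

definition wt :: "nat \<times> nat \<Rightarrow> nat" where
  "wt p = \<psi> (fst p div d)"

definition sat :: "'k mpoly3 set" where
  "sat = saturation I varZ"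

definition corner :: "'k mpoly3 set" where
  "corner = {mon (i * d) (e * (r + s - Suc i)) 0 1 | i. i < r + s}"

definition Q :: "'k mpoly3 set" where
  "Q = gen_ideal (sat \<union> corner)"

text \<open>After inverting z this says that the monomials, each divided by z to its weight, agree
  modulo \<open>sat\<close>. Congruence replaces connectedness by links, so no paths need to be
  followed.\<close>

definition rel :: "nat \<times> nat \<Rightarrow> nat \<times> nat \<Rightarrow> bool" where
  "rel p q \<longleftrightarrow> mon (fst p) (snd p) (wt q) 1 - mon (fst q) (snd q) (wt p) 1 \<in> sat"

definition cls :: "nat \<times> nat \<Rightarrow> (nat \<times> nat) set" where
  "cls p = {q \<in> low. rel p q}"

text \<open>The bridge between \<open>I\<close> and \<open>Q\<close>: a common kernel of
  \<open>k[z]\<close>-linear maps, shown to contain \<open>I\<close> and to lie in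
  \<open>Q\<close>.\<close>

definition K :: "'k mpoly3 set" where
  "K = {f. \<forall>p. weigh wt (cls p) f = 0}"

lemma I_ideal: "is_ideal I"
  unfolding I_def by (rule gen_ideal_is_ideal)

lemma sat_ideal: "is_ideal sat"
  unfolding sat_def by (rule saturation_is_ideal[OF I_ideal])

lemma I_sub_sat: "I \<subseteq> sat"
  unfolding sat_def by (rule saturation_superset)

lemma Q_ideal: "is_ideal Q"
  unfolding Q_def by (rule gen_ideal_is_ideal)

lemma edge_r: "mon (i + d * r) j (l + a) 1 - mon i (j + e * r) l 1 \<in> I"
proof -
  have "mon i j l 1 * (mon (d * r) 0 a 1 - mon 0 (e * r) 0 1) \<in> I"
    unfolding I_def by (intro is_idealD(3)[OF gen_ideal_is_ideal] gen_ideal_superset) simp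
  then show ?thesis by (simp add: right_diff_distrib mult_single)
qed

lemma edge_s: "mon (i + d * s) j (l + b) 1 - mon i (j + e * s) l 1 \<in> I"
proof -
  have "mon i j l 1 * (mon (d * s) 0 b 1 - mon 0 (e * s) 0 1) \<in> I"
    unfolding I_def by (intro is_idealD(3)[OF gen_ideal_is_ideal] gen_ideal_superset) simp
  then show ?thesis by (simp add: right_diff_distrib mult_single)
qed

section \<open>Classes of monomials modulo the saturation\<close>

lemma rel_refl: "rel p p"
  using is_idealD(1)[OF sat_ideal] by (simp add: rel_def)

lemma rel_sym: "rel p q \<Longrightarrow> rel q p"
  unfolding rel_def
  using is_idealD(3)[OF sat_ideal, of "mon (fst p) (snd p) (wt q) 1 - mon (fst q) (snd q) (wt p) 1" "-1"]
  by simp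

lemma rel_trans:
  assumes "rel p q" "rel q t"
  shows "rel p t"
proof -
  \<comment> \<open>The extra factor lets the two congruences telescope, and saturation removes it
    afterwards.\<close>
  have "varZ ^ wt q * (mon (fst p) (snd p) (wt t) 1 - mon (fst t) (snd t) (wt p) 1) =
      varZ ^ wt t * (mon (fst p) (snd p) (wt q) 1 - mon (fst q) (snd q) (wt p) 1) +
      varZ ^ wt p * (mon (fst q) (snd q) (wt t) 1 - mon (fst t) (snd t) (wt q) (1::'k))"
    by (simp add: varZ_power right_diff_distrib mult_single add.commute)
  also have "\<dots> \<in> sat"
    using assms is_idealD(2,3)[OF sat_ideal] unfolding rel_def by simp
  finally show ?thesis
    unfolding rel_def sat_def by (rule saturation_cancel)
qed

lemma rel_cong: "rel q t \<Longrightarrow> rel p q \<longleftrightarrow> rel p t"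
  by (rule iffI) (erule rel_trans, assumption, erule rel_trans, erule rel_sym)

lemma cls_cong:
  assumes "rel p q"
  shows "cls p = cls q"
proof -
  have "rel p t \<longleftrightarrow> rel q t" for t
    using rel_trans[of p q t] rel_trans[of q p t] rel_sym[of p q] assms by iprover
  then show ?thesis by (simp add: cls_def)
qed

text \<open>A link preserves the degree in u and v, so its ends are both low or both not. If low,
  they share a class, and the increment \<open>c\<close> of the potential offsets the extra power of
  z.\<close>

lemma edge_weigh:
  assumes edge: "\<And>l. mon (i + d * t) j (l + c) 1 - mon i (j + e * t) l 1 \<in> I"
    and \<psi>: "\<And>i. Suc (i + t) < r + s \<Longrightarrow> \<psi> i = \<psi> (i + t) + c"
  shows "weigh wt (cls p) (mon (i + d * t) j (l + c) k - mon i (j + e * t) l k) = 0"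
proof (cases "(i + d * t, j) \<in> low")
  case True
  have low': "(i, j + e * t) \<in> low"
    using True pos by (simp add: low_def ac_simps)
  have \<psi>_i: "\<psi> (i div d) = \<psi> (i div d + t) + c"
    using True pos by (intro \<psi>) (simp add: low_def)
  have wt: "wt (i + d * t, j) = \<psi> (i div d + t)" "wt (i, j + e * t) = \<psi> (i div d + t) + c"
    using pos \<psi>_i by (simp_all add: wt_def add.commute)
  have "rel (i + d * t, j) (i, j + e * t)"
    using subsetD[OF I_sub_sat edge[of "\<psi> (i div d + t)"]] by (simp add: rel_def wt)
  then have "(i + d * t, j) \<in> cls p \<longleftrightarrow> (i, j + e * t) \<in> cls p"
    using True low' rel_cong[of "(i + d * t, j)" "(i, j + e * t)" p] by (simp add: cls_def)
  then show ?thesis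
    by (simp add: weigh_diff weigh_mon wt ac_simps)
next
  case False
  then have "(i, j + e * t) \<notin> low"
    using pos by (simp add: low_def ac_simps)
  then show ?thesis
    using False by (simp add: weigh_diff weigh_mon cls_def)
qed

section \<open>Comparing \<open>K\<close> with \<open>I\<close>, the corner ideal and
  \<open>Q\<close>\<close>

lemma K_0: "0 \<in> K" and K_add: "f \<in> K \<Longrightarrow> g \<in> K \<Longrightarrow> f + g \<in> K"
  by (simp_all add: K_def weigh_add)

lemma I_sub_K: "I \<subseteq> K"
proof (subst I_def, rule gen_ideal_subset_additive[OF K_0 K_add])
  fix g :: "'k mpoly3" and i j l and c :: 'k
  assume "g \<in> {mon (d * r) 0 a 1 - mon 0 (e * r) 0 1, mon (d * s) 0 b 1 - mon 0 (e * s) 0 1}"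
  then show "mon i j l c * g \<in> K"
    using edge_weigh[OF edge_r \<psi>_r] edge_weigh[OF edge_s \<psi>_s]
    by (auto simp: K_def right_diff_distrib mult_single)
qed auto

lemma corner_sub_K: "gen_ideal corner \<subseteq> K"
proof (rule gen_ideal_subset_additive[OF K_0 K_add])
  fix g :: "'k mpoly3" and i j l and c :: 'k
  assume "g \<in> corner"
  then obtain k where k: "g = mon (k * d) (e * (r + s - Suc k)) 0 1" "k < r + s"
    unfolding corner_def by blast
  have "(i + k * d, j + e * (r + s - Suc k)) \<notin> low"
    using pos k(2) by (simp add: low_def)
  then show "mon i j l c * g \<in> K"
    by (simp add: k(1) K_def mult_single weigh_mon cls_def)
qed auto

lemma high_mon:
  assumes "(i, j) \<notin> low"
  shows "mon i j l c \<in> gen_ideal corner"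
proof -
  \<comment> \<open>The cap at \<open>r + s - 1\<close> selects a corner monomial dividing the given
    one even when the u-exponent alone is already too large.\<close>
  define k where "k = min (i div d) (r + s - 1)"
  have k: "k < r + s" using pos by (simp add: k_def)
  have "r + s - Suc k \<le> j div e"
    using assms pos by (auto simp: low_def k_def min_def)
  then have j: "e * (r + s - Suc k) \<le> j"
    using pos(4) by (metis mult.commute mult_le_mono1 order_trans div_times_less_eq_dividend)
  have "k * d \<le> i div d * d"
    by (simp add: k_def)
  then have i: "k * d \<le> i"
    by (rule order_trans) (rule div_times_less_eq_dividend)
  have "mon i j l c = mon (i - k * d) (j - e * (r + s - Suc k)) l c *
      mon (k * d) (e * (r + s - Suc k)) 0 1"
    using i j by (simp add: mult_single)
  moreover have "mon (k * d) (e * (r + s - Suc k)) 0 1 \<in> gen_ideal corner"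
    using k by (intro gen_ideal_superset) (auto simp: corner_def)
  ultimately show ?thesis
    using is_idealD(3)[OF gen_ideal_is_ideal] by metis
qed

lemma corner_sub_Q: "gen_ideal corner \<subseteq> Q"
  unfolding Q_def by (rule gen_ideal_mono) simp

lemma sat_sub_Q: "sat \<subseteq> Q"
  unfolding Q_def by (auto intro: gen_ideal_superset)

lemma K_sub_Q: "K \<subseteq> Q"
proof
  fix f assume f: "f \<in> K"
  define xy where "xy m = (fst m, fst (snd m))" for m :: "nat \<times> nat \<times> nat"
  define T where "T m = Poly_Mapping.single m (Poly_Mapping.lookup f m)" for m
  define A where "A = {m \<in> Poly_Mapping.keys f. xy m \<in> low}"
  have fin: "finite A" by (simp add: A_def)
  have "sum T (Poly_Mapping.keys f - A) \<in> Q"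
  proof (rule is_ideal_sum[OF Q_ideal])
    fix m assume "m \<in> Poly_Mapping.keys f - A"
    then show "T m \<in> Q"
      using high_mon corner_sub_Q by (cases m) (auto simp: A_def xy_def T_def)
  qed
  moreover have "sum T A \<in> Q"
    \<comment> \<open>The low part is split by class, and each piece will lie in
      \<open>sat\<close>.\<close>
    unfolding sum.image_gen[OF fin, of T "\<lambda>m. cls (xy m)"]
  proof (rule is_ideal_sum[OF Q_ideal])
    fix C assume "C \<in> (\<lambda>m. cls (xy m)) ` A"
    then obtain m where "m \<in> A" "C = cls (xy m)" by blast
    then obtain p where p: "p \<in> low" "C = cls p"
      unfolding A_def by blast
    have "m \<in> A \<and> cls (xy m) = C \<longleftrightarrow> m \<in> Poly_Mapping.keys f \<and> xy m \<in> C" for m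
    proof
      assume m: "m \<in> A \<and> cls (xy m) = C"
      then have "xy m \<in> low"
        by (simp add: A_def)
      then have "xy m \<in> cls (xy m)"
        by (simp add: cls_def rel_refl)
      then show "m \<in> Poly_Mapping.keys f \<and> xy m \<in> C"
        using m by (simp add: A_def)
    next
      assume m: "m \<in> Poly_Mapping.keys f \<and> xy m \<in> C"
      then show "m \<in> A \<and> cls (xy m) = C"
        using cls_cong[of p "xy m"] by (simp add: A_def p cls_def)
    qed
    then have "sum T {m \<in> A. cls (xy m) = C} = restrict_xy C f"
      unfolding restrict_xy_conv_sum T_def xy_def by simp
    moreover have "restrict_xy C f \<in> sat"
    proof -
      have "mon i j (wt p) 1 - mon (fst p) (snd p) (wt (i, j)) 1 \<in> sat" if "(i, j) \<in> C" for i j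
        using that rel_sym[of p "(i, j)"] by (simp add: p cls_def rel_def)
      note restrict_xy_congruent[where f = f and w = wt and S = C, OF sat_ideal this]
      moreover have "weigh wt C f = 0"
        using f unfolding K_def p by blast
      ultimately have "varZ ^ wt p * restrict_xy C f \<in> sat"
        by simp
      then show ?thesis
        unfolding sat_def by (rule saturation_cancel)
    qed
    ultimately show "sum T {m \<in> A. cls (xy m) = C} \<in> Q"
      using sat_sub_Q by auto
  qed
  ultimately have "sum T (Poly_Mapping.keys f - A) + sum T A \<in> Q"
    by (rule is_idealD(2)[OF Q_ideal])
  also have "sum T (Poly_Mapping.keys f - A) + sum T A = sum T (Poly_Mapping.keys f)"
    by (rule sum.subset_diff[symmetric]) (auto simp: A_def)
  also have "\<dots> = f"
    unfolding T_def by (rule sum_single_lookup)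
  finally show "f \<in> Q" .
qed

text \<open>\<open>K\<close> is a kernel of \<open>k[z]\<close>-linear maps into the domain
  k[z].\<close>

lemma torsion_K:
  assumes "poly_z p ^ m * f \<in> K" "p \<noteq> 0"
  shows "f \<in> K"
  using assms by (auto simp: K_def weigh_poly_z_power_mult)

text \<open>The two extreme corner monomials are pure powers of x and y.\<close>

lemma xy_sub_radical_corner: "gen_ideal {varX, varY} \<subseteq> radical (gen_ideal corner)"
proof (rule gen_ideal_least[OF radical_is_ideal[OF gen_ideal_is_ideal]])
  have "varX ^ ((r + s - 1) * d) \<in> gen_ideal corner"
    unfolding varX_power using pos
    by (intro gen_ideal_superset) (auto simp: corner_def intro!: exI[of _ "r + s - 1"])
  moreover have "varY ^ (e * (r + s - 1)) \<in> gen_ideal corner"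
    unfolding varY_power using pos
    by (intro gen_ideal_superset) (auto simp: corner_def intro!: exI[of _ 0])
  ultimately show "{varX, varY} \<subseteq> radical (gen_ideal corner)"
    unfolding radical_def by blast
qed

text \<open>Replace \<open>h\<close> by its part in \<open>k[z]\<close>: the difference is nilpotent modulo \<open>gen_ideal corner\<close>.\<close>

lemma localization_sub_Q:
  assumes "h * f \<in> I" "at_xy0 h \<noteq> 0"
  shows "f \<in> Q"
proof -
  define h0 where "h0 = poly_z (at_xy0 h)"
  obtain m where m: "(h - h0) ^ m \<in> gen_ideal corner"
    using diff_poly_z_at_xy0[of h] xy_sub_radical_corner unfolding h0_def radical_def by blast
  \<comment> \<open>The cofactor in \<open>h0 ^ m - (h0 - h) ^ m = h * c\<close>, from the
    factorisation of a difference of powers.\<close>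
  define c where "c = (\<Sum>i<m. (h0 - h) ^ (m - Suc i) * h0 ^ i)"
  have "h0 ^ m - (h0 - h) ^ m = h * c"
    using power_diff_sumr2[of h0 m "h0 - h"] by (simp add: c_def)
  moreover have "(h0 - h) ^ m = (- 1) ^ m * (h - h0) ^ m"
    by (simp flip: power_mult_distrib)
  ultimately have "h0 ^ m = c * h + (- 1) ^ m * (h - h0) ^ m"
    by (simp add: algebra_simps)
  then have "h0 ^ m * f = c * (h * f) + ((- 1) ^ m * f) * (h - h0) ^ m"
    by (simp add: algebra_simps)
  moreover have "c * (h * f) \<in> K"
    using is_idealD(3)[OF I_ideal assms(1)] I_sub_K by blast
  moreover have "((- 1) ^ m * f) * (h - h0) ^ m \<in> K"
    using is_idealD(3)[OF gen_ideal_is_ideal m] corner_sub_K by blast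
  ultimately have "h0 ^ m * f \<in> K"
    using K_add by simp
  then show ?thesis
    using torsion_K assms(2) K_sub_Q unfolding h0_def by blast
qed

text \<open>The contraction to k[x,y,z] of the extension of \<open>I\<close> to the localisation at
  \<langle>x, y\<rangle>.\<close>

definition loc :: "'k mpoly3 set" where
  "loc = {f. \<exists>h. at_xy0 h \<noteq> 0 \<and> h * f \<in> I}"

lemma loc_ideal: "is_ideal loc"
proof -
  have "f + g \<in> loc" if "at_xy0 h \<noteq> 0" "h * f \<in> I" "at_xy0 k \<noteq> 0" "k * g \<in> I" for f g h k
  proof -
    have "(h * k) * (f + g) = k * (h * f) + h * (k * g)"
      by (simp add: algebra_simps)
    then have "(h * k) * (f + g) \<in> I"
      using is_idealD(2,3)[OF I_ideal] that by simp
    then show ?thesis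
      unfolding loc_def using that by (auto simp: at_xy0_mult intro!: exI[of _ "h * k"])
  qed
  moreover have "k * f \<in> loc" if "at_xy0 h \<noteq> 0" "h * f \<in> I" for f h k
    using is_idealD(3)[OF I_ideal that(2), of k] that(1) unfolding loc_def
    by (auto simp: mult.left_commute)
  moreover have "0 \<in> loc"
    unfolding loc_def using is_idealD(1)[OF I_ideal] by (auto intro!: exI[of _ 1])
  ultimately show ?thesis unfolding is_ideal_def loc_def by blast
qed

lemma sat_sub_loc: "sat \<subseteq> loc"
proof
  fix f assume "f \<in> sat"
  then obtain m where "varZ ^ m * f \<in> I"
    unfolding sat_def saturation_def by blast
  moreover have "at_xy0 (varZ ^ m :: 'k mpoly3) \<noteq> 0"
    by (simp add: varZ_power at_xy0_mon monom_eq_0_iff)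
  ultimately show "f \<in> loc"
    unfolding loc_def by blast
qed

text \<open>In degree \<open>n - 1\<close> (with \<open>n = r + s\<close>), the two relations move the exponent \<open>i\<close> of \<open>u\<close> to
  \<open>i + r mod n\<close>.  After \<open>n\<close> steps the walk closes up, and its monodromy is
  \<open>z^(b r) = z^(a s)\<close>.\<close>

lemma walk:
  assumes "i0 < r + s"
  shows "\<exists>p q i. p + q = t \<and> i < r + s \<and> i0 + r * p = i + s * q \<and>
    mon (i0 * d) (e * (r + s - Suc i0)) (b * q) 1 - mon (i * d) (e * (r + s - Suc i)) (a * p) 1 \<in> I"
proof (induction t)
  case 0
  show ?case
    using assms is_idealD(1)[OF I_ideal] by (intro exI[of _ 0] exI[of _ i0]) simp
next
  case (Suc t)
  define E where "E i l = mon (i * d) (e * (r + s - Suc i)) l (1::'k)" for i l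
  obtain p q i where IH: "p + q = t" "i < r + s" "i0 + r * p = i + s * q" "E i0 (b * q) - E i (a * p) \<in> I"
    using Suc.IH unfolding E_def by blast
  show ?case
  \<comment> \<open>\<open>p\<close> and \<open>q\<close> count the steps by \<open>r\<close> and by
    \<open>s\<close>. Below \<open>s\<close> there is room to add \<open>r\<close>; otherwise
    \<open>s\<close> can be subtracted.\<close>
  proof (cases "i < s")
    case True
    have "r + s - Suc i = (r + s - Suc (i + r)) + r"
      using True by simp
    then have "e * (r + s - Suc i) = e * (r + s - Suc (i + r)) + e * r"
      by (simp only: distrib_left)
    then have "E (i + r) (a * p + a) - E i (a * p) \<in> I"
      using edge_r[of "i * d" "e * (r + s - Suc (i + r))" "a * p"]
      by (simp add: E_def algebra_simps)
    then have "E i0 (b * q) - E i (a * p) - (E (i + r) (a * p + a) - E i (a * p)) \<in> I"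
      by (rule is_ideal_diff[OF I_ideal IH(4)])
    then have "E i0 (b * q) - E (i + r) (a * Suc p) \<in> I"
      by (simp add: add.commute)
    then show ?thesis
      using IH True unfolding E_def
      by (intro exI[of _ "Suc p"] exI[of _ q] exI[of _ "i + r"]) simp
  next
    case False
    define j where "j = i - s"
    have i: "i = j + s" using False by (simp add: j_def)
    have "r + s - Suc j = (r + s - Suc i) + s"
      using IH(2) i by simp
    then have "e * (r + s - Suc j) = e * (r + s - Suc i) + e * s"
      by (simp only: distrib_left)
    then have "E i (a * p + b) - E j (a * p) \<in> I"
      using edge_s[of "j * d" "e * (r + s - Suc i)" "a * p"]
      by (simp add: E_def i algebra_simps)
    \<comment> \<open>A step down gains a factor z^b on the current monomial, so the congruence
      reached so far is multiplied by z^b to match.\<close>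
    moreover have "varZ ^ b * (E i0 (b * q) - E i (a * p)) \<in> I"
      by (rule is_idealD(3)[OF I_ideal IH(4)])
    then have "E i0 (b * q + b) - E i (a * p + b) \<in> I"
      by (simp add: E_def varZ_power right_diff_distrib mult_single add.commute)
    ultimately have "E i0 (b * q + b) - E i (a * p + b) + (E i (a * p + b) - E j (a * p)) \<in> I"
      by (intro is_idealD(2)[OF I_ideal])
    then have "E i0 (b * Suc q) - E j (a * p) \<in> I"
      by (simp add: add.commute)
    then show ?thesis
      using IH i unfolding E_def
      by (intro exI[of _ p] exI[of _ "Suc q"] exI[of _ j]) simp
  qed
qed

lemma corner_sub_loc: "corner \<subseteq> loc"
proof
  fix g assume "g \<in> corner"
  then obtain i0 where i0: "g = mon (i0 * d) (e * (r + s - Suc i0)) 0 1" "i0 < r + s"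
    unfolding corner_def by blast
  obtain p q i where w: "p + q = r + s" "i < r + s" "i0 + r * p = i + s * q"
      "mon (i0 * d) (e * (r + s - Suc i0)) (b * q) 1 - mon (i * d) (e * (r + s - Suc i)) (a * p) 1 \<in> I"
    using walk[OF i0(2), of "r + s"] by blast
  \<comment> \<open>Substituting \<open>q = r + s - p\<close> turns the balance of the walk into one
    modulo \<open>r + s\<close>, which forces \<open>i = i0\<close>, \<open>p = s\<close> and
    \<open>q = r\<close>.\<close>
  have eq: "i0 + (r + s) * p = i + (r + s) * s"
  proof -
    have "i0 + (r + s) * p = i + s * (p + q)"
      using w(3) by (simp add: algebra_simps)
    then show ?thesis by (simp add: w(1) algebra_simps)
  qed
  then have "(i0 + (r + s) * p) mod (r + s) = (i + (r + s) * s) mod (r + s)"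
    by simp
  then have "i = i0" using i0(2) w(2) by simp
  moreover from this eq have "p = s" using pos by simp
  moreover from this w(1) have "q = r" by simp
  ultimately have "(mon 0 0 (b * r) 1 - mon 0 0 (a * s) 1) * g \<in> I"
    using w(4) by (simp add: i0(1) left_diff_distrib mult_single)
  moreover have "at_xy0 (mon 0 0 (b * r) 1 - mon 0 0 (a * s) (1::'k)) \<noteq> 0"
    using rank by (simp add: at_xy0_diff at_xy0_mon monom_eq_iff')
  ultimately show "g \<in> loc"
    unfolding loc_def by blast
qed

text \<open>The cycle in degree \<open>r + s - 1\<close> gives one inclusion, the potential below
  that degree the other.\<close>

lemma Q_eq_loc: "Q = loc"
proof
  show "Q \<subseteq> loc"
    unfolding Q_def using sat_sub_loc corner_sub_loc by (intro gen_ideal_least[OF loc_ideal]) simp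
  show "loc \<subseteq> Q"
    unfolding loc_def using localization_sub_Q by blast
qed

section \<open>Radical and primariness of \<open>Q\<close>\<close>

lemma I_sub_xy: "f \<in> I \<Longrightarrow> at_xy0 f = 0"
proof -
  have "I \<subseteq> gen_ideal {varX, varY}"
    unfolding I_def using pos
    by (intro gen_ideal_least gen_ideal_is_ideal) (simp add: gen_ideal_xy at_xy0_diff at_xy0_mon)
  then show "f \<in> I \<Longrightarrow> at_xy0 f = 0"
    by (auto simp: gen_ideal_xy)
qed

lemma Q_sub_xy:
  assumes "f \<in> Q"
  shows "at_xy0 f = 0"
proof -
  obtain h where "at_xy0 h \<noteq> 0" "h * f \<in> I"
    using assms unfolding Q_eq_loc loc_def by blast
  then show ?thesis
    using I_sub_xy[of "h * f"] by (simp add: at_xy0_mult)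
qed

lemma radical_Q: "radical Q = gen_ideal {varX, varY}"
proof
  show "radical Q \<subseteq> gen_ideal {varX, varY}"
  proof
    fix f assume "f \<in> radical Q"
    then obtain m where "f ^ m \<in> Q"
      unfolding radical_def by blast
    then show "f \<in> gen_ideal {varX, varY}"
      using Q_sub_xy[of "f ^ m"] by (simp add: gen_ideal_xy at_xy0_power)
  qed
  show "gen_ideal {varX, varY} \<subseteq> radical Q"
    using xy_sub_radical_corner corner_sub_Q unfolding radical_def by blast
qed

lemma primary_Q: "primary_ideal Q"
  unfolding primary_ideal_def
proof (intro conjI allI impI)
  show "is_ideal Q" by (rule Q_ideal)
  show "Q \<noteq> UNIV"
    using Q_sub_xy[of 1] by auto
  fix f g assume "f * g \<in> Q"
  then obtain h where h: "at_xy0 h \<noteq> 0" "h * (f * g) \<in> I"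
    unfolding Q_eq_loc loc_def by blast
  show "f \<in> Q \<or> g \<in> radical Q"
  proof (cases "at_xy0 g = 0")
    case True
    then show ?thesis by (simp add: radical_Q gen_ideal_xy)
  next
    case False
    \<comment> \<open>A factor outside the prime ideal is absorbed into the multiplier
      \<open>h\<close>.\<close>
    then have "at_xy0 (h * g) \<noteq> 0" "(h * g) * f \<in> I"
      using h by (simp_all add: at_xy0_mult ac_simps)
    then show ?thesis
      using localization_sub_Q by blast
  qed
qed

theorem primary_component: "is_primary_component I (gen_ideal {varX, varY}) Q"
proof (rule is_primary_componentI[OF noetherian_mpoly3 I_ideal primary_Q radical_Q])
  show "I \<subseteq> Q" using I_sub_sat sat_sub_Q by blast
  fix f assume "f \<in> Q"
  then show "\<exists>h. h \<notin> gen_ideal {varX, varY} \<and> h * f \<in> I"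
    unfolding Q_eq_loc loc_def gen_ideal_xy by blast
qed

end

section \<open>Reduction to coprime exponents\<close>

lemma lexp_mult:
  assumes "lam * of_nat d = of_nat e"
  shows "lexp lam (d * k) = e * k"
proof -
  have "lam * of_nat (d * k) = (lam * of_nat d) * of_nat k"
    by simp
  also have "\<dots> = of_int (int (e * k))"
    unfolding assms by simp
  finally show ?thesis
    unfolding lexp_def by (simp only: floor_of_int nat_int)
qed

text \<open>Bezout's identity writes the gcd as an integer combination of \<open>r\<close> and
  \<open>s\<close>.\<close>

lemma gcd_multiple_Ints:
  fixes lam :: rat
  assumes "lam * of_nat r \<in> \<int>" "lam * of_nat s \<in> \<int>"
  shows "lam * of_nat (gcd r s) \<in> \<int>"
proof -
  obtain u v where "u * int r + v * int s = gcd (int r) (int s)"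
    using bezout_int by blast
  then have "of_nat (gcd r s) = of_int u * of_nat r + (of_int v * of_nat s :: rat)"
    by (metis gcd_int_int_eq of_int_add of_int_mult of_int_of_nat_eq)
  then have "lam * of_nat (gcd r s) = of_int u * (lam * of_nat r) + of_int v * (lam * of_nat s)"
    by (simp add: algebra_simps)
  then show ?thesis using assms by simp
qed

theorem theorem4p7:
  fixes r s a b d :: nat and lam :: rat
    and I :: "'k::{alg_closed_field, field_char_0} mpoly3 set"
  assumes "0 < r" "0 < s" "0 < a" "0 < b" "a \<le> b" "s \<le> r"
    and "d = gcd r s"
    and "0 < lam"
    and "lam * of_nat r \<in> \<int>" "lam * of_nat s \<in> \<int>"
    and rank2: "\<forall>u v :: rat.
        u * of_nat r + v * of_nat s = 0 \<and>
        u * (- lam * of_nat r) + v * (- lam * of_nat s) = 0 \<and>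
        u * of_nat a + v * of_nat b = 0 \<longrightarrow> u = 0 \<and> v = 0"
    and "I = gen_ideal {varX ^ r * varZ ^ a - varY ^ lexp lam r,
                        varX ^ s * varZ ^ b - varY ^ lexp lam s}"
  shows "is_primary_component I (gen_ideal {varX, varY})
           (gen_ideal (saturation I varZ \<union>
              {varX ^ (i * d) * varY ^ lexp lam (r + s - (i + 1) * d) | i. i < (r + s) div d}))"
proof -
  have "0 < d" using assms(1,7) by simp
  obtain r' s' where "r = r' * d" "s = s' * d" and coprime: "coprime r' s'"
    using gcd_coprime_exists[of r s, folded assms(7)] \<open>0 < d\<close> by blast
  then have rs: "r = d * r'" "s = d * s'"
    by (simp_all only: mult.commute)
  have pos': "0 < r'" "0 < s'" using assms(1,2) rs by auto
  have "lam * of_nat d \<in> \<int>"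
    using gcd_multiple_Ints assms(7,9,10) by blast
  then obtain k where k: "lam * of_nat d = of_int k" by (elim Ints_cases)
  have "(0::rat) < of_int k"
    using assms(8) \<open>0 < d\<close> by (simp flip: k)
  define e where "e = nat k"
  have e: "lam * of_nat d = of_nat e" "0 < e"
    using k \<open>(0::rat) < of_int k\<close> by (simp_all add: e_def)
  note lexp = lexp_mult[OF e(1)]
  have "b * r' \<noteq> a * s'"
  proof
    assume "b * r' = a * s'"
    then have "b * r = a * s" by (simp add: rs)
    then have "(of_nat (b * r) :: rat) = of_nat (a * s)" by simp
    then have "(of_nat s :: rat) = 0"
      \<comment> \<open>The vector (s, -r) kills the first two rows of the matrix, and under the
        assumed equality also the third.\<close>
      using rank2[rule_format, of "of_nat s" "- of_nat r"] by (simp add: algebra_simps)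
    then show False using assms(2) by simp
  qed
  obtain \<psi> where \<psi>: "\<And>i. Suc (i + r') < r' + s' \<Longrightarrow> \<psi> i = \<psi> (i + r') + a"
      "\<And>i. Suc (i + s') < r' + s' \<Longrightarrow> \<psi> i = \<psi> (i + s') + b"
    using potential_exists[OF coprime pos'] by blast
  interpret binomial_pair r' s' a b d e \<psi> I
  proof
    show "I = gen_ideal {mon (d * r') 0 a 1 - mon 0 (e * r') 0 1, mon (d * s') 0 b 1 - mon 0 (e * s') 0 1}"
      unfolding assms(12) rs(1,2) lexp by (simp add: varX_power varY_power varZ_power mult_single)
  qed (fact pos' \<open>0 < d\<close> e(2) \<open>b * r' \<noteq> a * s'\<close> \<psi>)+
  have "(r + s) div d = r' + s'"
    using \<open>0 < d\<close> by (simp add: rs flip: distrib_left)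
  moreover have "r + s - (i + 1) * d = d * (r' + s' - Suc i)" for i
    by (simp add: rs algebra_simps)
  ultimately have "corner = {varX ^ (i * d) * varY ^ lexp lam (r + s - (i + 1) * d) | i. i < (r + s) div d}"
    by (simp add: corner_def lexp varX_power varY_power mult_single)
  then show ?thesis
    using primary_component unfolding Q_def sat_def by simp
qed

end
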